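(* Let $\Omega,\Omega^*\subseteq\mathbb R^2$ be open and simply connected, $T:\Omega\to\Omega^*$ a $C^1$ bijective map, $Sx=Tx-x$, $a>0$, $\kappa_1>1$. Given $x_0\in\Omega$ satisfying $a>\dfrac{|Sx_0|}{\sqrt{\kappa_1^2-1}}$ and $z_0$ verifying $a>z_0>\dfrac{|Sx_0|}{\sqrt{\kappa_1^2-1}}$, if $$\nabla\times S=0\qquad\text{and}\qquad S\times D|S|^2=0$$ hold for every $x$ in an open set containing $x_0$, then the system of PDEs $$D\rho(x)=\frac{\kappa_1\,Sx}{\sqrt{|Sx|^2+(a-\rho(x))^2}-\kappa_1(a-\rho(x))}$$ has a unique positive $C^2$ solution $\rho$ in a neighborhood of $x_0$ satisfying $$a>a-\rho(x)>\frac{|Sx|}{\sqrt{\kappa_1^2-1}}$$ for every $x$ in that neighborhood, with $a-\rho(x_0)=z_0$.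
   Context: For a planar $C^1$ field $S=(S_1,S_2)$ of $x=(x_1,x_2)$, $\nabla\times S=(S_2)_{x_1}-(S_1)_{x_2}$. For planar vectors ${\bf a}=(a_1,a_2)$, ${\bf b}=(b_1,b_2)$, ${\bf a}\times{\bf b}=a_1b_2-a_2b_1$. $D\rho$ and $D|S|^2$ denote gradients (row vectors) of $\rho$ and of $x\mapsto|Sx|^2$. *)

theory Defs
  imports "HOL-Analysis.Analysis"
begin

text \<open>Only meaningful where f is differentiable, since \<^const>\<open>frechet_derivative\<close> is an
  arbitrary value elsewhere; it is used below only for functions that are at least of class C1.\<close>

definition partial_deriv :: "2 \<Rightarrow> (real^2 \<Rightarrow> 'b::real_normed_vector) \<Rightarrow> real^2 \<Rightarrow> 'b" where
  "partial_deriv i f x = frechet_derivative f (at x) (axis i 1)"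

text \<open>Class C^k on a set, which is meant to be open: f is differentiable at each point of it and
  all partial derivatives are of class C^(k-1). For k = 0 this is continuity, and for k > 0
  differentiability is total (Frechet) differentiability, equivalent on open sets to existence
  of the partial derivatives since these are continuous.\<close>

fun Ck_on :: "nat \<Rightarrow> (real^2 \<Rightarrow> 'b::real_normed_vector) \<Rightarrow> (real^2) set \<Rightarrow> bool" where
  "Ck_on 0 f U \<longleftrightarrow> continuous_on U f"
| "Ck_on (Suc k) f U \<longleftrightarrow>
     (\<forall>x\<in>U. f differentiable (at x)) \<and> (\<forall>i. Ck_on k (partial_deriv i f) U)"

definition grad :: "(real^2 \<Rightarrow> real) \<Rightarrow> real^2 \<Rightarrow> real^2" where
  "grad f x = (\<chi> i. partial_deriv i f x)"

definition curl2 :: "(real^2 \<Rightarrow> real^2) \<Rightarrow> real^2 \<Rightarrow> real" where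
  "curl2 S x = partial_deriv 1 (\<lambda>y. S y $ 2) x - partial_deriv 2 (\<lambda>y. S y $ 1) x"

definition cross2 :: "real^2 \<Rightarrow> real^2 \<Rightarrow> real" where
  "cross2 a b = a $ 1 * b $ 2 - a $ 2 * b $ 1"

text \<open>The function \<open>\<rho>\<close> is total, but only its values on the open set U matter. The lower bound on
  \<open>a - \<rho> x\<close> makes the denominator of the equation negative, so there is no division by zero.\<close>

definition positive_solution ::
  "real \<Rightarrow> real \<Rightarrow> (real^2 \<Rightarrow> real^2) \<Rightarrow> real^2 \<Rightarrow> real \<Rightarrow> (real^2) set \<Rightarrow> (real^2 \<Rightarrow> real) \<Rightarrow> bool" where
  "positive_solution \<kappa>1 a S x0 z0 U \<rho> \<longleftrightarrow>
     Ck_on 2 \<rho> U \<and>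
     (\<forall>x\<in>U. \<rho> x > 0) \<and>
     (\<forall>x\<in>U. grad \<rho> x =
        (\<kappa>1 / (sqrt ((norm (S x))\<^sup>2 + (a - \<rho> x)\<^sup>2) - \<kappa>1 * (a - \<rho> x))) *\<^sub>R S x) \<and>
     (\<forall>x\<in>U. a > a - \<rho> x \<and> a - \<rho> x > norm (S x) / sqrt (\<kappa>1\<^sup>2 - 1)) \<and>
     a - \<rho> x0 = z0"

end

theory Submission
  imports Defs
begin

text \<open>Write the system as \<open>D\<rho> = G(x, \<rho>) S\<close>, where \<open>G(x, r)\<close> depends on \<open>x\<close> only through
  \<open>|Sx|\<close>. If \<open>D\<rho>\<close> is parallel to \<open>S\<close>, then so is the gradient of \<open>x \<mapsto> G(x, \<rho> x)\<close> (because
  \<open>S \<times> D|S|\<^sup>2 = 0\<close>), and since \<open>S\<close> is curl free the field \<open>G(x, \<rho>) S\<close> is curl free too. By the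
  Poincare lemma on a ball it is the gradient of a next iterate, again with gradient parallel to
  \<open>S\<close>. So Picard iteration can be run directly on functions of two variables, without solving
  ODEs along curves and differentiating in a parameter: on a small ball the iterates and their
  gradients converge uniformly. Uniqueness is the same contraction estimate on small balls plus
  connectedness.\<close>

subsection \<open>Gradient systems\<close>

text \<open>Poincare lemma on a convex set: the potential is the integral of \<open>F\<close> along
  the segment from \<open>x0\<close> to \<open>x\<close>. After differentiation under the integral
  sign, symmetry makes the integrand the t-derivative of t F(p x t) \<bullet> v, so the integral
  collapses to F x \<bullet> v. Continuity of \<open>F'\<close> is asked only in each fixed
  direction, which in finite dimension gives continuity as an operator.\<close>

lemma symmetric_derivative_imp_gradient:
  fixes F :: "'a::euclidean_space \<Rightarrow> 'a"
  assumes "open U" "convex U" "x0 \<in> U"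
    and F: "\<And>x. x \<in> U \<Longrightarrow> (F has_derivative F' x) (at x)"
    and cont: "\<And>v. continuous_on U (\<lambda>x. F' x v)"
    and sym: "\<And>x v w. x \<in> U \<Longrightarrow> F' x v \<bullet> w = F' x w \<bullet> v"
  shows "\<exists>f. f x0 = c \<and> (\<forall>x\<in>U. (f has_derivative (\<lambda>v. F x \<bullet> v)) (at x))"
proof -
  define p where "p x t = x0 + t *\<^sub>R (x - x0)" for x and t :: real
  have pU: "p x t \<in> U" if "x \<in> U" "t \<in> {0..1}" for x t
    using convexD_alt[OF \<open>convex U\<close> \<open>x0 \<in> U\<close> \<open>x \<in> U\<close>, of t] that
    by (auto simp: p_def algebra_simps)
  have F'lin: "bounded_linear (F' x)" if "x \<in> U" for x
    using F[OF that] by (rule has_derivative_bounded_linear)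
  have contF: "continuous_on U F"
    using F by (auto intro!: continuous_at_imp_continuous_on has_derivative_continuous)
  \<comment> \<open>\<open>E x t\<close> is the derivative in x of the integrand F(p x t) \<bullet>
    (x - x0), the segment parameter t being fixed.\<close>
  define E where "E x t v = F' (p x t) (t *\<^sub>R v) \<bullet> (x - x0) + F (p x t) \<bullet> v" for x t v
  have Elin: "bounded_linear (E x t)" if "x \<in> U" "t \<in> {0..1}" for x t
    unfolding E_def
    by (intro bounded_linear_intros bounded_linear_compose[OF F'lin] pU that)
  \<comment> \<open>\<open>leibniz_rule\<close> expects the derivative as a
    bounded-linear-map-valued function. The wrapper represents \<open>E x t\<close> faithfully only
    where that map is known to be linear, that is for \<open>x\<close> in \<open>U\<close> and
    \<open>t\<close> in [0,1].\<close>
  define fx where "fx x t = Blinfun (E x t)" for x t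
  have fx: "blinfun_apply (fx x t) = E x t" if "x \<in> U" "t \<in> {0..1}" for x t
    unfolding fx_def using Elin[OF that] by (rule bounded_linear_Blinfun_apply)
  have contp: "continuous_on (U \<times> {0..1}) (\<lambda>(x, t). p x t)"
    unfolding p_def split_beta by (intro continuous_intros)
  have contE: "continuous_on (U \<times> {0..1}) (\<lambda>(x, t). E x t v)" for v
  proof -
    have *: "continuous_on (U \<times> {0..1}) (\<lambda>(x, t). h (p x t))"
      if "continuous_on U h" for h :: "'a \<Rightarrow> 'a"
      using continuous_on_compose2[OF that contp] pU by (fastforce simp: split_beta)
    have "continuous_on (U \<times> {0..1}) 
        (\<lambda>z. (snd z *\<^sub>R F' (p (fst z) (snd z)) v) \<bullet> (fst z - x0) + F (p (fst z) (snd z)) \<bullet> v)"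
      using *[OF cont[of v]] *[OF contF] by (intro continuous_intros) (auto simp: split_beta)
    then show ?thesis
      by (rule continuous_on_cong[THEN iffD1, rotated -1])
        (auto simp: E_def linear_cmul[OF bounded_linear.linear[OF F'lin[OF pU]]])
  qed
  have cfx: "continuous_on (U \<times> cbox 0 1) (\<lambda>(x, t). fx x t)"
  proof (rule continuous_on_blinfun_componentwise)
    fix i :: 'a
    show "continuous_on (U \<times> cbox 0 1) (\<lambda>z. blinfun_apply (case z of (x, t) \<Rightarrow> fx x t) i)"
      using contE[of i]
      by (rule continuous_on_cong[THEN iffD1, rotated -1]) (auto simp: fx)
  qed
  define f where "f x = c + integral (cbox 0 1) (\<lambda>t. F (p x t) \<bullet> (x - x0))" for x
  have cpt: "continuous_on {0..1} (\<lambda>t. h (p x t))" if "continuous_on U h" "x \<in> U" for h :: "'a \<Rightarrow> 'a" and x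
    by (rule continuous_on_compose2[OF that(1)])
      (use pU that in \<open>auto simp: p_def intro!: continuous_intros\<close>)
  have "(f has_derivative (\<lambda>v. F x \<bullet> v)) (at x)" if x: "x \<in> U" for x
  proof -
    have d: "((\<lambda>x. F (p x t) \<bullet> (x - x0)) has_derivative blinfun_apply (fx y t)) (at y within U)"
      if y: "y \<in> U" and t: "t \<in> cbox 0 1" for y t
    proof -
      have "((\<lambda>x. p x t) has_derivative (\<lambda>v. t *\<^sub>R v)) (at y)"
        unfolding p_def by (auto intro!: derivative_eq_intros simp: algebra_simps)
      then have "((\<lambda>x. F (p x t)) has_derivative (\<lambda>v. F' (p y t) (t *\<^sub>R v))) (at y)"
        by (rule has_derivative_compose) (use F[OF pU[OF y]] t in auto)
      then have "((\<lambda>x. F (p x t) \<bullet> (x - x0)) has_derivative E y t) (at y)"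
        unfolding E_def
        by (auto intro!: derivative_eq_intros simp: algebra_simps)
      then show ?thesis using fx y t by (auto intro: has_derivative_at_withinI)
    qed
    have "((\<lambda>x. integral (cbox 0 1) (\<lambda>t. F (p x t) \<bullet> (x - x0))) has_derivative
        integral (cbox 0 1) (fx x)) (at x within U)"
    proof (rule leibniz_rule[OF d _ cfx x \<open>convex U\<close>])
      show "(\<lambda>t. F (p y t) \<bullet> (y - x0)) integrable_on cbox 0 1" if "y \<in> U" for y
        using cpt[OF contF that] by (intro integrable_continuous continuous_intros) auto
    qed auto
    moreover
    have "blinfun_apply (integral (cbox 0 1) (fx x)) v = F x \<bullet> v" for v
    proof -
      have "continuous_on {0..1} (fx x)"
        using continuous_on_compose2[OF cfx, of "{0..1}" "\<lambda>t. (x, t)"] x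
        by (fastforce intro!: continuous_intros)
      then have "blinfun_apply (integral (cbox 0 1) (fx x)) v = integral (cbox 0 1) (\<lambda>t. fx x t v)"
        by (intro blinfun_apply_integral integrable_continuous) auto
      also have "\<dots> = integral {0..1} (\<lambda>t. E x t v)"
        using fx x unfolding cbox_interval by (intro integral_cong) auto
      also have "\<dots> = (1 *\<^sub>R F (p x 1)) \<bullet> v - (0 *\<^sub>R F (p x 0)) \<bullet> v"
      proof (rule integral_unique, rule fundamental_theorem_of_calculus)
        fix t :: real assume t: "t \<in> {0..1}"
        have "(p x has_derivative (\<lambda>s. s *\<^sub>R (x - x0))) (at t)"
          unfolding p_def by (auto intro!: derivative_eq_intros)
        then have "((\<lambda>t. F (p x t)) has_derivative (\<lambda>s. F' (p x t) (s *\<^sub>R (x - x0)))) (at t)"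
          by (rule has_derivative_compose) (rule F[OF pU[OF x t]])
        then have "((\<lambda>t. (t *\<^sub>R F (p x t)) \<bullet> v) has_derivative
            (\<lambda>s. (t *\<^sub>R F' (p x t) (s *\<^sub>R (x - x0)) + s *\<^sub>R F (p x t)) \<bullet> v)) (at t)"
          by (auto intro!: derivative_eq_intros simp: inner_add_left)
        \<comment> \<open>Here symmetry enters: the product rule yields F'(x - x0) \<bullet> v,
          whereas \<open>E\<close> contains F'(v) \<bullet> (x - x0).\<close>
        also have "(\<lambda>s. (t *\<^sub>R F' (p x t) (s *\<^sub>R (x - x0)) + s *\<^sub>R F (p x t)) \<bullet> v) =
            (\<lambda>s. s * E x t v)"
          by (simp add: fun_eq_iff E_def inner_add_left distrib_left sym[OF pU[OF x t], of "x - x0" v]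
                linear_cmul[OF bounded_linear.linear[OF F'lin[OF pU[OF x t]]]])
        finally have "((\<lambda>t. (t *\<^sub>R F (p x t)) \<bullet> v) has_derivative (\<lambda>s. s * E x t v)) (at t)" .
        then show "((\<lambda>t. (t *\<^sub>R F (p x t)) \<bullet> v) has_vector_derivative E x t v) (at t within {0..1})"
          by (auto simp: has_vector_derivative_def intro: has_derivative_at_withinI)
      qed auto
      finally show ?thesis by (simp add: p_def)
    qed
    then have "blinfun_apply (integral (cbox 0 1) (fx x)) = (\<lambda>v. F x \<bullet> v)" by (rule ext)
    ultimately have "((\<lambda>x. integral (cbox 0 1) (\<lambda>t. F (p x t) \<bullet> (x - x0))) has_derivative
        (\<lambda>v. F x \<bullet> v)) (at x within U)"
      by simp
    then have "(f has_derivative (\<lambda>v. F x \<bullet> v)) (at x within U)"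
      unfolding f_def by (auto intro!: derivative_eq_intros)
    then show ?thesis using at_within_open[OF x \<open>open U\<close>] by simp
  qed
  moreover have "f x0 = c" by (simp add: f_def)
  ultimately show ?thesis by blast
qed

text \<open>Mean value inequality for a gradient k S of norm at most C M. It serves three times
  below: to confine the iterates, to contract their differences, and to contract the difference of
  two solutions.\<close>

lemma gradient_system_increment_bound:
  fixes S :: "'a::euclidean_space \<Rightarrow> 'a"
  assumes f: "\<And>x. x \<in> ball p d \<Longrightarrow> (f has_derivative (\<lambda>v. k x * (S x \<bullet> v))) (at x)"
    and k: "\<And>x. x \<in> ball p d \<Longrightarrow> \<bar>k x\<bar> \<le> C"
    and S: "\<And>x. x \<in> ball p d \<Longrightarrow> norm (S x) \<le> M"
    and x: "x \<in> ball p d"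
  shows "\<bar>f x - f p\<bar> \<le> C * M * d"
proof -
  have p: "p \<in> ball p d" using x by (auto intro: le_less_trans[OF zero_le_dist])
  have C: "C \<ge> 0" using k[OF p] by simp
  have M: "M \<ge> 0" using S[OF p] norm_ge_zero[of "S p"] by linarith
  have "norm (f x - f p) \<le> C * M * norm (x - p)"
  proof (rule differentiable_bound[OF convex_ball _ _ x p])
    show "(f has_derivative (\<lambda>v. k y * (S y \<bullet> v))) (at y within ball p d)" if "y \<in> ball p d" for y
      using f[OF that] by (rule has_derivative_at_withinI)
    show "onorm (\<lambda>v. k y * (S y \<bullet> v)) \<le> C * M" if y: "y \<in> ball p d" for y
    proof (rule onorm_le)
      fix v
      have "\<bar>S y \<bullet> v\<bar> \<le> M * norm v"
        using Cauchy_Schwarz_ineq2[of "S y" v] mult_right_mono[OF S[OF y], of "norm v"] by simp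
      then show "norm (k y * (S y \<bullet> v)) \<le> C * M * norm v"
        using mult_mono[OF k[OF y], of "\<bar>S y \<bullet> v\<bar>" "M * norm v"] C by (simp add: abs_mult mult.assoc)
    qed
  qed
  also have "\<dots> \<le> C * M * d"
    using x C M by (intro mult_left_mono) (auto simp: dist_norm norm_minus_commute)
  finally show ?thesis by simp
qed

text \<open>Picard iteration with the existence of the next iterate isolated in the hypothesis
  \<open>step\<close>: a field G(x, \<rho>) S has to be a gradient, and this is demanded only for
  those \<rho> whose own gradient is a continuous multiple of \<open>S\<close>. The first smallness
  condition keeps the iterates within \<open>e\<close> of \<open>r0\<close>, the second makes every
  step halve the sup distance.\<close>

lemma picard_gradient_system:
  fixes S :: "'a::euclidean_space \<Rightarrow> 'a" and G :: "'a \<Rightarrow> real \<Rightarrow> real"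
  assumes "d > 0" "e > 0" "K \<ge> 0" "L \<ge> 0" "M \<ge> 0"
    and S: "\<And>x. x \<in> ball x0 d \<Longrightarrow> norm (S x) \<le> M"
    and GK: "\<And>x s. x \<in> ball x0 d \<Longrightarrow> \<bar>s - r0\<bar> \<le> e \<Longrightarrow> \<bar>G x s\<bar> \<le> K"
    and GL: "\<And>x s t. x \<in> ball x0 d \<Longrightarrow> \<bar>s - r0\<bar> \<le> e \<Longrightarrow> \<bar>t - r0\<bar> \<le> e \<Longrightarrow>
               \<bar>G x s - G x t\<bar> \<le> L * \<bar>s - t\<bar>"
    and small: "K * M * d \<le> e" "L * M * d \<le> 1 / 2"
    and step: "\<And>\<rho> k. continuous_on (ball x0 d) k \<Longrightarrow>
        (\<And>x. x \<in> ball x0 d \<Longrightarrow> (\<rho> has_derivative (\<lambda>v. k x * (S x \<bullet> v))) (at x)) \<Longrightarrow>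
        (\<And>x. x \<in> ball x0 d \<Longrightarrow> \<bar>\<rho> x - r0\<bar> \<le> e) \<Longrightarrow>
        continuous_on (ball x0 d) (\<lambda>x. G x (\<rho> x)) \<and>
        (\<exists>\<sigma>. \<sigma> x0 = r0 \<and> (\<forall>x\<in>ball x0 d. (\<sigma> has_derivative (\<lambda>v. G x (\<rho> x) * (S x \<bullet> v))) (at x)))"
  shows "\<exists>\<rho>. \<rho> x0 = r0 \<and> (\<forall>x\<in>ball x0 d. \<bar>\<rho> x - r0\<bar> \<le> e \<and>
           (\<rho> has_derivative (\<lambda>v. G x (\<rho> x) * (S x \<bullet> v))) (at x))"
proof -
  let ?B = "ball x0 d"
  have x0: "x0 \<in> ?B" using \<open>d > 0\<close> by simp
  \<comment> \<open>\<open>P\<close> is the invariant under which \<open>step\<close> applies.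
    \<open>Q\<close> says that its second argument is a next iterate of the first; it is a relation
    because \<open>step\<close> only asserts existence, so the sequence comes from dependent
    choice.\<close>
  define P where "P \<rho> \<longleftrightarrow> \<rho> x0 = r0 \<and> (\<forall>x\<in>?B. \<bar>\<rho> x - r0\<bar> \<le> e) \<and>
     (\<exists>k. continuous_on ?B k \<and> (\<forall>x\<in>?B. (\<rho> has_derivative (\<lambda>v. k x * (S x \<bullet> v))) (at x)))"
    for \<rho>
  define Q where "Q \<rho> \<sigma> \<longleftrightarrow> (\<forall>x\<in>?B. (\<sigma> has_derivative (\<lambda>v. G x (\<rho> x) * (S x \<bullet> v))) (at x))"
    for \<rho> \<sigma> :: "'a \<Rightarrow> real"
  have "\<exists>f. \<forall>n. P (f n) \<and> Q (f n) (f (Suc n))"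
  proof (rule dependent_nat_choice)
    show "\<exists>\<rho>. P \<rho>"
      unfolding P_def using \<open>e > 0\<close>
      by (intro exI[of _ "\<lambda>_. r0"] conjI exI[of _ "\<lambda>_. 0"]) auto
    fix \<rho> :: "'a \<Rightarrow> real" and n :: nat
    assume P: "P \<rho>"
    then have "continuous_on ?B (\<lambda>x. G x (\<rho> x)) \<and> (\<exists>\<sigma>. \<sigma> x0 = r0 \<and> Q \<rho> \<sigma>)"
      unfolding P_def Q_def using step by blast
    then obtain \<sigma> where cont: "continuous_on ?B (\<lambda>x. G x (\<rho> x))" and \<sigma>: "\<sigma> x0 = r0" "Q \<rho> \<sigma>"
      by blast
    have "\<bar>\<sigma> x - r0\<bar> \<le> e" if "x \<in> ?B" for x
    proof -
      have "\<bar>\<sigma> x - \<sigma> x0\<bar> \<le> K * M * d"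
      proof (rule gradient_system_increment_bound[where k = "\<lambda>x. G x (\<rho> x)", OF _ _ S that])
        show "(\<sigma> has_derivative (\<lambda>v. G y (\<rho> y) * (S y \<bullet> v))) (at y)" if "y \<in> ?B" for y
          using \<sigma>(2) that by (simp add: Q_def)
        show "\<bar>G y (\<rho> y)\<bar> \<le> K" if "y \<in> ?B" for y
          using P GK[OF that] that by (simp add: P_def)
      qed
      then show ?thesis using \<sigma>(1) small(1) by simp
    qed
    then have "P \<sigma>"
      unfolding P_def using cont \<sigma> unfolding Q_def by blast
    with \<sigma> show "\<exists>\<sigma>. P \<sigma> \<and> Q \<rho> \<sigma>" by blast
  qed
  then obtain f where P: "\<And>n. P (f n)" and Q: "\<And>n. Q (f n) (f (Suc n))" by blast
  have fe: "\<bar>f n x - r0\<bar> \<le> e" if "x \<in> ?B" for n x using P[of n] that by (auto simp: P_def)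
  have f0: "f n x0 = r0" for n using P[of n] by (auto simp: P_def)
  \<comment> \<open>The constant 2 e bounds the distance of any two functions staying within
    \<open>e\<close> of \<open>r0\<close>. Consecutive iterates agree at \<open>x0\<close>, and
    their gradients differ by the increment of \<open>G\<close> times \<open>S\<close>, so each step
    gains the factor L M d \<le> 1/2.\<close>
  have diff: "\<bar>f (Suc n) x - f n x\<bar> \<le> 2 * e * (1/2)^n" if "x \<in> ?B" for n x
    using that
  proof (induction n arbitrary: x)
    case 0
    show ?case using fe[OF 0, of 0] fe[OF 0, of "Suc 0"] by simp
  next
    case (Suc n)
    let ?C = "L * (2 * e * (1/2)^n)"
    have "\<bar>(f (Suc (Suc n)) x - f (Suc n) x) - (f (Suc (Suc n)) x0 - f (Suc n) x0)\<bar> \<le> ?C * M * d"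
    proof (rule gradient_system_increment_bound[where f = "\<lambda>x. f (Suc (Suc n)) x - f (Suc n) x", OF _ _ S Suc.prems, where k = "\<lambda>x. G x (f (Suc n) x) - G x (f n x)"])
      fix y assume y: "y \<in> ?B"
      show "((\<lambda>a. f (Suc (Suc n)) a - f (Suc n) a) has_derivative
          (\<lambda>v. (G y (f (Suc n) y) - G y (f n y)) * (S y \<bullet> v))) (at y)"
        using Q[of n] Q[of "Suc n"] y unfolding Q_def
        by (auto intro!: derivative_eq_intros simp: algebra_simps)
      show "\<bar>G y (f (Suc n) y) - G y (f n y)\<bar> \<le> ?C"
        using GL[OF y fe[OF y] fe[OF y], of "Suc n" n] mult_left_mono[OF Suc.IH[OF y] \<open>L \<ge> 0\<close>]
        by linarith
    qed
    also have "?C * M * d = (L * M * d) * (2 * e * (1/2)^n)" by simp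
    also have "\<dots> \<le> 1/2 * (2 * e * (1/2)^n)"
      using small(2) \<open>e > 0\<close> by (intro mult_right_mono) auto
    finally show ?case by (simp add: f0)
  qed
  have tail: "\<bar>f (n + m) x - f n x\<bar> \<le> 4 * e * (1/2)^n" if x: "x \<in> ?B" for n m x
  proof -
    \<comment> \<open>The partial geometric sum is kept exactly, since the bound without its last
      factor would not pass through the induction on \<open>m\<close>.\<close>
    have "\<bar>f (n + m) x - f n x\<bar> \<le> 4 * e * (1/2)^n * (1 - (1/2)^m)"
    proof (induction m)
      case (Suc m)
      have "\<bar>f (n + Suc m) x - f n x\<bar> \<le> \<bar>f (Suc (n + m)) x - f (n + m) x\<bar> + \<bar>f (n + m) x - f n x\<bar>"
        by simp
      also have "\<dots> \<le> 2 * e * (1/2)^(n+m) + 4 * e * (1/2)^n * (1 - (1/2)^m)"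
        using diff[OF x, of "n+m"] Suc by linarith
      also have "\<dots> = 4 * e * (1/2)^n * (1 - (1/2)^Suc m)" by (simp add: power_add algebra_simps)
      finally show ?case .
    qed simp
    also have "\<dots> \<le> 4 * e * (1/2)^n" using \<open>e > 0\<close> by (simp add: mult_left_le)
    finally show ?thesis .
  qed
  \<comment> \<open>The free constant \<open>C\<close> lets one decay statement serve both pointwise
    convergence (C = 1) and uniform convergence of the gradients (C = L M).\<close>
  have small_tail: "\<forall>\<^sub>F n in sequentially. C * (4 * e * (1/2)^n) < \<eta>" if "\<eta> > 0" for C \<eta> :: real
  proof -
    have "(\<lambda>n. C * (4 * e * (1/2)^n)) \<longlonglongrightarrow> C * (4 * e * 0)"
      by (intro tendsto_intros) auto
    then show ?thesis using order_tendstoD(2)[of _ 0] that by simp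
  qed
  have "Cauchy (\<lambda>n. f n x)" if x: "x \<in> ?B" for x
  proof (rule CauchyI')
    fix \<eta> :: real assume "\<eta> > 0"
    then obtain N where N: "\<And>n. n \<ge> N \<Longrightarrow> 4 * e * (1/2)^n < \<eta>"
      using small_tail[of \<eta> 1] by (auto simp: eventually_sequentially)
    have "dist (f m x) (f n x) < \<eta>" if "m \<ge> N" "n > m" for m n
      using tail[OF x, of m "n - m"] N[OF that(1)] that by (simp add: dist_real_def abs_minus_commute)
    then show "\<exists>M. \<forall>m\<ge>M. \<forall>n>m. dist (f m x) (f n x) < \<eta>" by blast
  qed
  then have "\<forall>x\<in>?B. \<exists>l. (\<lambda>n. f n x) \<longlonglongrightarrow> l"
    using Cauchy_convergent_iff convergent_def by blast
  then obtain \<rho> where lim: "\<And>x. x \<in> ?B \<Longrightarrow> (\<lambda>n. f n x) \<longlonglongrightarrow> \<rho> x" by metis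
  have \<rho>e: "\<bar>\<rho> x - r0\<bar> \<le> e" if "x \<in> ?B" for x
    by (rule tendsto_upperbound[of "\<lambda>n. \<bar>f n x - r0\<bar>" _ sequentially])
      (auto intro!: tendsto_intros lim that fe always_eventually)
  have \<rho>tail: "\<bar>f n x - \<rho> x\<bar> \<le> 4 * e * (1/2)^n" if x: "x \<in> ?B" for n x
  proof (rule tendsto_upperbound[of "\<lambda>m. \<bar>f n x - f m x\<bar>" _ sequentially])
    show "\<forall>\<^sub>F m in sequentially. \<bar>f n x - f m x\<bar> \<le> 4 * e * (1/2)^n"
      using tail[OF x, of n] by (intro eventually_sequentiallyI[of n])
        (metis abs_minus_commute le_add_diff_inverse)
  qed (auto intro!: tendsto_intros lim x)
  \<comment> \<open>Uniform convergence of the gradients allows differentiating the limit. The index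
    is shifted because \<open>Q\<close> describes the gradient of \<open>f (Suc n)\<close> in terms
    of \<open>f n\<close>.\<close>
  have "\<exists>g. \<forall>x\<in>?B. (\<lambda>n. f (Suc n) x) \<longlonglongrightarrow> g x \<and>
      (g has_derivative (\<lambda>v. G x (\<rho> x) * (S x \<bullet> v))) (at x within ?B)"
  proof (rule has_derivative_sequence[OF convex_ball _ _ x0, where f' = "\<lambda>n x v. G x (f n x) * (S x \<bullet> v)"])
    show "(f (Suc n) has_derivative (\<lambda>v. G x (f n x) * (S x \<bullet> v))) (at x within ?B)"
      if "x \<in> ?B" for n x
      using Q[of n] that by (auto simp: Q_def intro: has_derivative_at_withinI)
    show "(\<lambda>n. f (Suc n) x0) \<longlonglongrightarrow> r0" by (simp add: f0)
    fix \<eta> :: real assume "\<eta> > 0"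
    show "\<forall>\<^sub>F n in sequentially. \<forall>x\<in>?B. \<forall>v.
        norm (G x (f n x) * (S x \<bullet> v) - G x (\<rho> x) * (S x \<bullet> v)) \<le> \<eta> * norm v"
      using small_tail[OF \<open>\<eta> > 0\<close>, of "L * M"]
    proof eventually_elim
      case (elim n)
      show ?case
      proof (intro ballI allI)
        fix x v assume x: "x \<in> ?B"
        have "\<bar>G x (f n x) - G x (\<rho> x)\<bar> \<le> L * (4 * e * (1/2)^n)"
          using GL[OF x fe[OF x] \<rho>e[OF x], of n] mult_left_mono[OF \<rho>tail[OF x, of n] \<open>L \<ge> 0\<close>]
          by linarith
        moreover have "\<bar>S x \<bullet> v\<bar> \<le> M * norm v"
          using Cauchy_Schwarz_ineq2[of "S x" v] mult_right_mono[OF S[OF x], of "norm v"] by simp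
        ultimately have "\<bar>G x (f n x) - G x (\<rho> x)\<bar> * \<bar>S x \<bullet> v\<bar> \<le> L * (4 * e * (1/2)^n) * (M * norm v)"
          using \<open>L \<ge> 0\<close> \<open>e > 0\<close> by (intro mult_mono) auto
        also have "\<dots> = (L * M * (4 * e * (1/2)^n)) * norm v" by simp
        also have "\<dots> \<le> \<eta> * norm v" using elim by (intro mult_right_mono) auto
        finally show "norm (G x (f n x) * (S x \<bullet> v) - G x (\<rho> x) * (S x \<bullet> v)) \<le> \<eta> * norm v"
          by (simp add: abs_mult left_diff_distrib[symmetric])
      qed
    qed
  qed
  then obtain g where g: "\<And>x. x \<in> ?B \<Longrightarrow> (\<lambda>n. f (Suc n) x) \<longlonglongrightarrow> g x"
    and dg: "\<And>x. x \<in> ?B \<Longrightarrow> (g has_derivative (\<lambda>v. G x (\<rho> x) * (S x \<bullet> v))) (at x within ?B)"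
    by blast
  have g\<rho>: "g x = \<rho> x" if "x \<in> ?B" for x
    using LIMSEQ_unique[OF g LIMSEQ_Suc[OF lim]] that by blast
  have "g x0 = r0" using LIMSEQ_unique[OF g[OF x0], of r0] by (simp add: f0)
  moreover have "\<bar>g x - r0\<bar> \<le> e \<and> (g has_derivative (\<lambda>v. G x (g x) * (S x \<bullet> v))) (at x)"
    if "x \<in> ?B" for x
    using dg[OF that] \<rho>e[OF that] g\<rho>[OF that] at_within_open[OF that open_ball] by simp
  ultimately show ?thesis by blast
qed

text \<open>The set where the two solutions agree is closed in \<open>V\<close> by continuity. It is
  open because around a point of agreement the contraction estimate can be iterated on a small ball.
  Connectedness then spreads agreement from \<open>x0\<close> to all of \<open>V\<close>.\<close>

lemma gradient_system_unique:
  fixes S :: "'a::euclidean_space \<Rightarrow> 'a" and G :: "'a \<Rightarrow> real \<Rightarrow> real"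
  assumes "open V" "connected V" "x0 \<in> V" "\<sigma> x0 = \<rho> x0"
    and \<rho>: "\<And>x. x \<in> V \<Longrightarrow> (\<rho> has_derivative (\<lambda>v. G x (\<rho> x) * (S x \<bullet> v))) (at x)"
    and \<sigma>: "\<And>x. x \<in> V \<Longrightarrow> (\<sigma> has_derivative (\<lambda>v. G x (\<sigma> x) * (S x \<bullet> v))) (at x)"
    and lip: "\<And>p. p \<in> V \<Longrightarrow> \<exists>d>0. \<exists>e>0. \<exists>L\<ge>0. \<exists>M\<ge>0. \<forall>x\<in>ball p d. norm (S x) \<le> M \<and>
        (\<forall>s t. \<bar>s - \<rho> p\<bar> \<le> e \<longrightarrow> \<bar>t - \<rho> p\<bar> \<le> e \<longrightarrow> \<bar>G x s - G x t\<bar> \<le> L * \<bar>s - t\<bar>)"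
    and x: "x \<in> V"
  shows "\<sigma> x = \<rho> x"
proof -
  have cont: "continuous_on V (\<lambda>x. \<sigma> x - \<rho> x)"
    using \<rho> \<sigma> by (intro continuous_at_imp_continuous_on ballI continuous_diff)
      (auto intro: has_derivative_continuous)
  let ?E = "{x \<in> V. \<sigma> x - \<rho> x = 0}"
  have "closedin (top_of_set V) ?E"
    using continuous_closedin_preimage_constant[OF cont, of 0] by simp
  moreover have "open ?E"
    unfolding open_contains_ball
  proof
    fix p assume "p \<in> ?E"
    then have p: "p \<in> V" "\<sigma> p = \<rho> p" by auto
    obtain d e L M where "d > 0" "e > 0" "L \<ge> 0" "M \<ge> 0"
      and S: "\<And>x. x \<in> ball p d \<Longrightarrow> norm (S x) \<le> M"
      and L: "\<And>x s t. x \<in> ball p d \<Longrightarrow> \<bar>s - \<rho> p\<bar> \<le> e \<Longrightarrow> \<bar>t - \<rho> p\<bar> \<le> e \<Longrightarrow>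
                \<bar>G x s - G x t\<bar> \<le> L * \<bar>s - t\<bar>"
      using lip[OF p(1)] by metis
    obtain d1 where "d1 > 0" and d1: "\<And>x. dist x p < d1 \<Longrightarrow> \<bar>\<rho> x - \<rho> p\<bar> < e"
      using has_derivative_continuous[OF \<rho>[OF p(1)]] \<open>e > 0\<close>
      unfolding continuous_at_eps_delta dist_real_def by blast
    obtain d2 where "d2 > 0" and d2: "\<And>x. dist x p < d2 \<Longrightarrow> \<bar>\<sigma> x - \<rho> p\<bar> < e"
      using has_derivative_continuous[OF \<sigma>[OF p(1)]] \<open>e > 0\<close> p(2)
      unfolding continuous_at_eps_delta dist_real_def by metis
    obtain d3 where "d3 > 0" and d3: "ball p d3 \<subseteq> V"
      using \<open>open V\<close> p(1) open_contains_ball by blast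
    \<comment> \<open>On this radius the local bounds hold, both solutions stay within
      \<open>e\<close> of their common value at \<open>p\<close>, the ball lies in \<open>V\<close>,
      and L M \<eta> \<le> 1/2. Adding 1 in the last denominator keeps it positive when L M =
      0.\<close>
    define \<eta> where "\<eta> = Min {d, d1, d2, d3, 1 / (2 * (L * M + 1))}"
    have LM: "L * M \<ge> 0" using \<open>L \<ge> 0\<close> \<open>M \<ge> 0\<close> by simp
    have "\<eta> > 0" unfolding \<eta>_def using \<open>d > 0\<close> \<open>d1 > 0\<close> \<open>d2 > 0\<close> \<open>d3 > 0\<close> LM
      by simp
    have \<eta>: "\<eta> \<le> d" "\<eta> \<le> d1" "\<eta> \<le> d2" "\<eta> \<le> d3" "\<eta> \<le> 1 / (2 * (L * M + 1))"
      unfolding \<eta>_def by simp_all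
    have "L * M * \<eta> \<le> L * M * (1 / (2 * (L * M + 1)))" using \<eta>(5) LM by (rule mult_left_mono)
    also have "\<dots> \<le> 1/2" using LM by (simp add: field_simps)
    finally have small: "L * M * \<eta> \<le> 1/2" .
    \<comment> \<open>The difference vanishes at \<open>p\<close>, so a bound on it over the ball
      improves by the factor 1/2 each time it is fed into the increment estimate. Letting
      \<open>n\<close> grow forces the difference to be 0.\<close>
    have bound: "\<bar>\<sigma> x - \<rho> x\<bar> \<le> 2 * e * (1/2)^n" if "x \<in> ball p \<eta>" for n x
      using that
    proof (induction n arbitrary: x)
      case 0
      then show ?case using d1[of x] d2[of x] \<eta> by (simp add: dist_commute)
    next
      case (Suc n)
      have "\<bar>(\<sigma> x - \<rho> x) - (\<sigma> p - \<rho> p)\<bar> \<le> L * (2 * e * (1/2)^n) * M * \<eta>"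
      proof (rule gradient_system_increment_bound[where f = "\<lambda>x. \<sigma> x - \<rho> x", OF _ _ _ Suc.prems,
            where k = "\<lambda>x. G x (\<sigma> x) - G x (\<rho> x)" and S = S])
        fix y assume y: "y \<in> ball p \<eta>"
        then have yV: "y \<in> V" using d3 \<eta>(4) by auto
        show "((\<lambda>a. \<sigma> a - \<rho> a) has_derivative
            (\<lambda>v. (G y (\<sigma> y) - G y (\<rho> y)) * (S y \<bullet> v))) (at y)"
          using \<rho>[OF yV] \<sigma>[OF yV]
          by (auto intro!: derivative_eq_intros simp: algebra_simps)
        show "norm (S y) \<le> M" using S y \<eta>(1) by auto
        have "\<bar>G y (\<sigma> y) - G y (\<rho> y)\<bar> \<le> L * \<bar>\<sigma> y - \<rho> y\<bar>"
          using y \<eta> d1[of y] d2[of y] by (intro L) (auto simp: dist_commute)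
        also have "\<dots> \<le> L * (2 * e * (1/2)^n)"
          using Suc.IH[OF y] \<open>L \<ge> 0\<close> by (rule mult_left_mono)
        finally show "\<bar>G y (\<sigma> y) - G y (\<rho> y)\<bar> \<le> L * (2 * e * (1/2)^n)" .
      qed
      also have "\<dots> = (L * M * \<eta>) * (2 * e * (1/2)^n)" by simp
      also have "\<dots> \<le> 1/2 * (2 * e * (1/2)^n)"
        using small \<open>e > 0\<close> by (intro mult_right_mono) auto
      finally show ?case using p(2) by simp
    qed
    have "\<sigma> x - \<rho> x = 0" if "x \<in> ball p \<eta>" for x
    proof -
      have "(\<lambda>n. 2 * e * (1/2)^n) \<longlonglongrightarrow> 2 * e * 0"
        by (intro tendsto_intros) auto
      then have "\<bar>\<sigma> x - \<rho> x\<bar> \<le> 2 * e * 0"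
        by (rule tendsto_lowerbound) (use bound[OF that] in \<open>auto intro: always_eventually\<close>)
      then show ?thesis by simp
    qed
    then show "\<exists>\<eta>>0. ball p \<eta> \<subseteq> ?E"
      using \<open>\<eta> > 0\<close> d3 \<eta>(4) by (intro exI[of _ \<eta>]) (auto simp: subset_iff)
  qed
  then have "openin (top_of_set V) ?E" by (intro open_subset) auto
  ultimately have "?E = {} \<or> ?E = V"
    using \<open>connected V\<close> unfolding connected_clopen by blast
  then show ?thesis using \<open>x0 \<in> V\<close> \<open>\<sigma> x0 = \<rho> x0\<close> x by auto
qed

subsection \<open>Planar calculus\<close>

lemma vec2_eq_axis: "v = v $ 1 *\<^sub>R axis 1 1 + v $ 2 *\<^sub>R axis 2 1" for v :: "real^2"
  by (simp add: vec_eq_iff forall_2 axis_def)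

lemma bounded_linear_vec2:
  fixes A :: "real^2 \<Rightarrow> 'b::real_normed_vector"
  assumes "bounded_linear A"
  shows "A v = v $ 1 *\<^sub>R A (axis 1 1) + v $ 2 *\<^sub>R A (axis 2 1)"
proof -
  interpret bounded_linear A by fact
  show ?thesis by (subst vec2_eq_axis[of v]) (simp only: add scaleR)
qed

lemma partial_deriv_eq: "(f has_derivative f') (at x) \<Longrightarrow> partial_deriv i f x = f' (axis i 1)"
proof -
  assume "(f has_derivative f') (at x)"
  then have "f' = frechet_derivative f (at x)" by (rule frechet_derivative_at)
  then show "partial_deriv i f x = f' (axis i 1)" by (simp add: partial_deriv_def)
qed

lemma grad_inner_eq:
  assumes "(f has_derivative f') (at x)"
  shows "f' = (\<lambda>v. grad f x \<bullet> v)"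
proof
  show "f' v = grad f x \<bullet> v" for v
    by (subst bounded_linear_vec2[OF has_derivative_bounded_linear[OF assms]])
      (simp add: grad_def inner_vec_def sum_2 partial_deriv_eq[OF assms])
qed

lemma grad_eq:
  assumes "(f has_derivative (\<lambda>v. g \<bullet> v)) (at x)"
  shows "grad f x = g"
proof -
  have "partial_deriv i f x = g $ i" for i
    by (simp add: partial_deriv_eq[OF assms] inner_axis)
  then show ?thesis  by (simp add: grad_def vec_eq_iff )
qed

text \<open>Written with \<open>Suc 0\<close>, the form on which the recursive equation of
  \<open>Ck_on\<close> matches.\<close>

lemma Ck_on_1I:
  assumes f: "\<And>x. x \<in> U \<Longrightarrow> (f has_derivative f' x) (at x)"
    and cont: "\<And>v. continuous_on U (\<lambda>x. f' x v)"
  shows "Ck_on (Suc 0) f U"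
proof -
  have "continuous_on U (partial_deriv i f)" for i
    using cont[of "axis i 1"]
    by (rule continuous_on_cong[THEN iffD1, rotated -1]) (simp_all add: partial_deriv_eq[OF f])
  then show ?thesis using f by (auto simp: differentiable_def)
qed

lemma Ck_on_1D:
  assumes "Ck_on (Suc 0) f U"
  shows "x \<in> U \<Longrightarrow> (f has_derivative frechet_derivative f (at x)) (at x)"
    and "continuous_on U (\<lambda>x. frechet_derivative f (at x) v)"
proof -
  show *: "(f has_derivative frechet_derivative f (at x)) (at x)" if "x \<in> U" for x
    using assms that frechet_derivative_works by auto
  have "continuous_on U (\<lambda>x. v $ 1 *\<^sub>R partial_deriv 1 f x + v $ 2 *\<^sub>R partial_deriv 2 f x)"
    using assms by (auto intro!: continuous_intros)
  then show "continuous_on U (\<lambda>x. frechet_derivative f (at x) v)"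
    by (rule continuous_on_cong[THEN iffD1, rotated -1])
      (auto simp: partial_deriv_def bounded_linear_vec2[OF has_derivative_bounded_linear[OF *], of _ v])
qed

text \<open>Reduces second order regularity to first order regularity of the gradient field
  \<open>F\<close>. The partial derivatives of \<rho> agree with the components of \<open>F\<close>
  only on \<open>U\<close>, and openness of \<open>U\<close> transfers differentiability between
  them.\<close>

lemma Ck_on_2I:
  fixes \<rho> :: "real^2 \<Rightarrow> real"
  assumes "open U"
    and \<rho>: "\<And>x. x \<in> U \<Longrightarrow> (\<rho> has_derivative (\<lambda>v. F x \<bullet> v)) (at x)"
    and F: "\<And>x. x \<in> U \<Longrightarrow> (F has_derivative F' x) (at x)"
    and cont: "\<And>v. continuous_on U (\<lambda>x. F' x v)"
  shows "Ck_on 2 \<rho> U"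
proof -
  have "Ck_on (Suc 0) (partial_deriv i \<rho>) U" for i
  proof (rule Ck_on_1I)
    show "(partial_deriv i \<rho> has_derivative (\<lambda>v. F' x v $ i)) (at x)" if "x \<in> U" for x
    proof (rule has_derivative_transform_within_open[OF _ \<open>open U\<close> that])
      show "((\<lambda>x. F x $ i) has_derivative (\<lambda>v. F' x v $ i)) (at x)"
        using F[OF that] by (rule bounded_linear.has_derivative[OF bounded_linear_vec_nth])
      show "F y $ i = partial_deriv i \<rho> y" if "y \<in> U" for y
        by (simp add: partial_deriv_eq[OF \<rho>[OF that]] inner_axis)
    qed
    show "continuous_on U (\<lambda>x. F' x v $ i)" for v
      using cont by (intro continuous_intros)
  qed
  moreover have "\<rho> differentiable at x" if "x \<in> U" for x
    using \<rho>[OF that] unfolding differentiable_def by blast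
  ultimately show ?thesis by (simp add: numeral_2_eq_2)
qed

text \<open>Vanishing curl equates the two off-diagonal entries of the Jacobian; expanding in the
  standard basis gives the coordinate-free symmetry used by
  \<open>symmetric_derivative_imp_gradient\<close>.\<close>

lemma curl2_eq_0_imp_symmetric:
  assumes S: "(S has_derivative S') (at x)" and "curl2 S x = 0"
  shows "S' v \<bullet> w = S' w \<bullet> v"
proof -
  have D: "((\<lambda>y. S y $ i) has_derivative (\<lambda>v. S' v $ i)) (at x)" for i
    using S by (rule bounded_linear.has_derivative[OF bounded_linear_vec_nth])
  have "S' (axis 1 1) $ 2 = S' (axis 2 1) $ 1"
    using assms(2) by (simp add: curl2_def partial_deriv_eq[OF D])
  then show ?thesis
    by (simp add: bounded_linear_vec2[OF has_derivative_bounded_linear[OF S], of v]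
        bounded_linear_vec2[OF has_derivative_bounded_linear[OF S], of w]
        inner_vec_def sum_2 algebra_simps)
qed

text \<open>The difference of the two sides factors as the product of \<open>cross2 a b\<close> and
  \<open>cross2 w v\<close>. This division-free form of parallelism also covers points where
  \<open>a\<close> vanishes.\<close>

lemma cross2_eq_0_imp_parallel:
  assumes "cross2 a b = 0"
  shows "(b \<bullet> v) * (a \<bullet> w) = (b \<bullet> w) * (a \<bullet> v)"
proof -
  have "(b \<bullet> v) * (a \<bullet> w) - (b \<bullet> w) * (a \<bullet> v) = cross2 a b * (v $ 2 * w $ 1 - v $ 1 * w $ 2)"
    by (simp add: cross2_def inner_vec_def sum_2 algebra_simps)
  with assms show ?thesis by simp
qed

text \<open>The derivative of |S|^2 in direction v is 2 S \<bullet> S' v, so this is the previous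
  lemma with D|S|^2 written through the derivative of \<open>S\<close>.\<close>

lemma cross2_grad_norm_sq_eq_0_imp_parallel:
  assumes S: "(S has_derivative S') (at x)"
    and "cross2 (S x) (grad (\<lambda>y. (norm (S y))\<^sup>2) x) = 0"
  shows "(S x \<bullet> S' v) * (S x \<bullet> w) = (S x \<bullet> S' w) * (S x \<bullet> v)"
proof -
  have D: "((\<lambda>y. (norm (S y))\<^sup>2) has_derivative (\<lambda>v. 2 * (S x \<bullet> S' v))) (at x)"
    unfolding power2_norm_eq_inner using S
    by (auto intro!: derivative_eq_intros simp: inner_commute)
  from cross2_eq_0_imp_parallel[OF assms(2), of v w] show ?thesis
    unfolding fun_cong[OF grad_inner_eq[OF D], symmetric] by simp
qed

subsection \<open>The refraction equation\<close>

text \<open>Here \<open>n\<close> stands for |Sx| and \<open>u\<close> for a - \<rho>(x), so that x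
  enters only through |Sx|.\<close>

definition refraction_factor :: "real \<Rightarrow> real \<Rightarrow> real \<Rightarrow> real" where
  "refraction_factor \<kappa> n u = \<kappa> / (sqrt (n\<^sup>2 + u\<^sup>2) - \<kappa> * u)"

text \<open>The slope condition is exactly negativity of the denominator of
  \<open>refraction_factor\<close>. Either side forces u > 0, and then both square to n^2 < u^2
  (\<kappa>^2 - 1). The estimates below work with the right-hand form.\<close>

lemma slope_condition_iff:
  fixes \<kappa> n u :: real
  assumes "\<kappa> > 1" "n \<ge> 0"
  shows "u > n / sqrt (\<kappa>\<^sup>2 - 1) \<longleftrightarrow> sqrt (n\<^sup>2 + u\<^sup>2) < \<kappa> * u"
proof -
  have c: "\<kappa>\<^sup>2 - 1 > 0" using assms by simp
  have "u > n / sqrt (\<kappa>\<^sup>2 - 1) \<longleftrightarrow> n < u * sqrt (\<kappa>\<^sup>2 - 1)"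
    using c by (simp add: divide_less_eq)
  also have "\<dots> \<longleftrightarrow> u > 0 \<and> n\<^sup>2 < u\<^sup>2 * (\<kappa>\<^sup>2 - 1)"
  proof -
    have "n < u * sqrt (\<kappa>\<^sup>2 - 1) \<longleftrightarrow> n\<^sup>2 < (u * sqrt (\<kappa>\<^sup>2 - 1))\<^sup>2" if "u > 0"
    proof -
      have w: "u * sqrt (\<kappa>\<^sup>2 - 1) \<ge> 0" using that c by simp
      show ?thesis
        using power_strict_mono[OF _ assms(2), of "u * sqrt (\<kappa>\<^sup>2 - 1)" 2] power2_less_imp_less[OF _ w]
        by fastforce
    qed
    moreover have "u > 0" if "n < u * sqrt (\<kappa>\<^sup>2 - 1)"
    proof -
      have "0 < u * sqrt (\<kappa>\<^sup>2 - 1)" using that assms(2) by linarith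
      then show ?thesis using c by (simp add: zero_less_mult_iff)
    qed
    ultimately show ?thesis using c by (auto simp: power_mult_distrib)
  qed
  also have "\<dots> \<longleftrightarrow> u > 0 \<and> n\<^sup>2 + u\<^sup>2 < (\<kappa> * u)\<^sup>2"
    by (auto simp: algebra_simps power_mult_distrib)
  also have "\<dots> \<longleftrightarrow> sqrt (n\<^sup>2 + u\<^sup>2) < \<kappa> * u"
  proof -
    have "u > 0" if "sqrt (n\<^sup>2 + u\<^sup>2) < \<kappa> * u"
    proof -
      have "0 \<le> sqrt (n\<^sup>2 + u\<^sup>2)" by simp
      then have "0 < \<kappa> * u" using that by linarith
      then show ?thesis using assms(1) by (simp add: zero_less_mult_iff)
    qed
    moreover have "sqrt (n\<^sup>2 + u\<^sup>2) < \<kappa> * u \<longleftrightarrow> n\<^sup>2 + u\<^sup>2 < (\<kappa> * u)\<^sup>2" if "u > 0"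
      using real_sqrt_less_iff[of "n\<^sup>2 + u\<^sup>2" "(\<kappa> * u)\<^sup>2"] that assms(1)
      by (simp only: real_sqrt_abs abs_of_pos mult_pos_pos order.strict_trans[OF zero_less_one])
    ultimately show ?thesis by blast
  qed
  finally show ?thesis .
qed

lemma abs_sqrt_sum_squares_diff_le:
  "\<bar>sqrt (n\<^sup>2 + u\<^sup>2) - sqrt (n\<^sup>2 + v\<^sup>2)\<bar> \<le> \<bar>u - v\<bar>" for n u v :: real
  using norm_triangle_ineq3[of "(n, u)" "(n, v)"] by (simp add: norm_Pair)

text \<open>With the denominator at most -m, the bound \<kappa> / m is immediate. The denominator is
  Lipschitz in \<open>u\<close> with constant \<kappa> + 1, the 1 coming from the square root and
  \<kappa> from the linear term; subtracting the two fractions gives the second bound.\<close>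

lemma refraction_factor_bounds:
  assumes "\<kappa> > 1" "m > 0" and u: "m \<le> \<kappa> * u - sqrt (n\<^sup>2 + u\<^sup>2)"
  shows "\<bar>refraction_factor \<kappa> n u\<bar> \<le> \<kappa> / m"
    and "m \<le> \<kappa> * v - sqrt (n\<^sup>2 + v\<^sup>2) \<Longrightarrow>
      \<bar>refraction_factor \<kappa> n u - refraction_factor \<kappa> n v\<bar> \<le> \<kappa> * (\<kappa> + 1) / m\<^sup>2 * \<bar>u - v\<bar>"
proof -
  define A where "A w = sqrt (n\<^sup>2 + w\<^sup>2) - \<kappa> * w" for w
  have Au: "A u \<le> - m" using u by (simp add: A_def)
  have "\<bar>\<kappa> / A u\<bar> = \<kappa> / \<bar>A u\<bar>" using assms(1) by simp
  also have "\<dots> \<le> \<kappa> / m" using Au assms(1,2) by (intro frac_le) auto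
  finally show "\<bar>refraction_factor \<kappa> n u\<bar> \<le> \<kappa> / m"
    by (simp add: refraction_factor_def A_def)
  assume v: "m \<le> \<kappa> * v - sqrt (n\<^sup>2 + v\<^sup>2)"
  have Av: "A v \<le> - m" using v by (simp add: A_def)
  have "m * m \<le> \<bar>A u\<bar> * \<bar>A v\<bar>" using Au Av assms(2) by (intro mult_mono) auto
  then have m2: "m\<^sup>2 \<le> \<bar>A u * A v\<bar>" by (simp add: power2_eq_square abs_mult)
  have "\<kappa> * \<bar>v - u\<bar> = \<bar>\<kappa> * v - \<kappa> * u\<bar>" using assms(1)
    by (simp add: abs_mult right_diff_distrib[symmetric])
  then have diff: "\<bar>A v - A u\<bar> \<le> (\<kappa> + 1) * \<bar>u - v\<bar>"
    using abs_sqrt_sum_squares_diff_le[of n v u] unfolding A_def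
    by (simp add: distrib_right abs_minus_commute)
  have "refraction_factor \<kappa> n u - refraction_factor \<kappa> n v = \<kappa> * (A v - A u) / (A u * A v)"
    unfolding refraction_factor_def A_def[symmetric] using Au Av assms(2)
    by (simp add: field_simps)
  then have "\<bar>refraction_factor \<kappa> n u - refraction_factor \<kappa> n v\<bar> = \<kappa> * \<bar>A v - A u\<bar> / \<bar>A u * A v\<bar>"
    using assms(1) by (simp add: abs_mult)
  also have "\<dots> \<le> \<kappa> * ((\<kappa> + 1) * \<bar>u - v\<bar>) / m\<^sup>2"
    using m2 diff assms(1,2) by (intro frac_le mult_left_mono) auto
  finally show "\<bar>refraction_factor \<kappa> n u - refraction_factor \<kappa> n v\<bar> \<le> \<kappa> * (\<kappa> + 1) / m\<^sup>2 * \<bar>u - v\<bar>"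
    by simp
qed

text \<open>By continuity the strict inequality at (p, r) persists nearby with half of its gap as a
  uniform margin \<open>m\<close>, which is what \<open>refraction_factor_bounds\<close>
  consumes.\<close>

lemma refraction_slope_margin:
  fixes S :: "'a::real_normed_vector \<Rightarrow> 'b::real_normed_vector"
  assumes S: "isCont S p" and r: "sqrt ((norm (S p))\<^sup>2 + (a - r)\<^sup>2) < \<kappa> * (a - r)"
  shows "\<exists>d>0. \<exists>e>0. \<exists>m>0. \<forall>x\<in>ball p d. norm (S x) \<le> norm (S p) + 1 \<and>
    (\<forall>s. \<bar>s - r\<bar> \<le> e \<longrightarrow> m \<le> \<kappa> * (a - s) - sqrt ((norm (S x))\<^sup>2 + (a - s)\<^sup>2))"
proof -
  define A where "A z = \<kappa> * (a - snd z) - sqrt ((norm (S (fst z)))\<^sup>2 + (a - snd z)\<^sup>2)" for z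
  have A0: "A (p, r) > 0" using r by (simp add: A_def)
  have "isCont A (p, r)"
    unfolding A_def by (intro continuous_intros isCont_o2[OF isCont_fst[OF continuous_ident]]) (auto intro: S)
  then obtain d1 where "d1 > 0" and d1: "\<And>z. dist z (p, r) < d1 \<Longrightarrow> \<bar>A z - A (p, r)\<bar> < A (p, r) / 2"
    using A0 unfolding continuous_at_eps_delta dist_real_def by (metis half_gt_zero)
  obtain d2 where "d2 > 0" and d2: "\<And>x. dist x p < d2 \<Longrightarrow> dist (S x) (S p) < 1"
    using S unfolding continuous_at_eps_delta by (metis zero_less_one)
  \<comment> \<open>The product distance is at most the sum of the two distances, and d1/2 + d1/3 <
    d1.\<close>
  have "A (p, r) / 2 \<le> A (x, s)" if "dist p x < min (d1/2) d2" "\<bar>s - r\<bar> \<le> d1/3" for x s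
  proof -
    have "dist (x, s) (p, r) \<le> dist x p + dist s r"
      unfolding dist_prod_def using sqrt_sum_squares_le_sum by simp
    also have "\<dots> < d1" using that \<open>d1 > 0\<close> unfolding dist_commute[of x p] dist_real_def by linarith
    finally show ?thesis using d1[of "(x, s)"] by linarith
  qed
  moreover have "norm (S x) \<le> norm (S p) + 1" if "dist p x < min (d1/2) d2" for x
    using d2[of x] that norm_triangle_sub[of "S x" "S p"]
    unfolding dist_commute[of x p] dist_norm[of "S x"] by linarith
  ultimately show ?thesis
    using \<open>d1 > 0\<close> \<open>d2 > 0\<close> A0
    by (intro exI[of _ "min (d1/2) d2"] conjI exI[of _ "d1/3"] exI[of _ "A (p, r) / 2"]) (auto simp: A_def)
qed

section \<open>Differentiability and symmetry of the refraction field\<close>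

lemma has_derivative_sqrt:
  assumes "(g has_derivative g') (at x)" "0 < g x"
  shows "((\<lambda>x. sqrt (g x)) has_derivative (\<lambda>v. g' v / (2 * sqrt (g x)))) (at x)"
proof -
  have "((\<lambda>x. sqrt (g x)) has_derivative (\<lambda>v. g' v * (inverse (sqrt (g x)) / 2))) (at x)"
    by (rule DERIV_compose_FDERIV[OF DERIV_real_sqrt[OF assms(2)] assms(1)])
  then show ?thesis
  by (simp add: field_simps)
qed

text \<open>The form of the derivative matters: besides the factor times S' v there is only a
  multiple of \<open>S x\<close>, whose coefficient is a combination of S \<bullet> S' v and S
  \<bullet> v.\<close>

lemma refraction_field_derivative:
  fixes S :: "'a::real_inner \<Rightarrow> 'a"
  assumes S: "(S has_derivative S') (at x)"
    and \<rho>: "(\<rho> has_derivative (\<lambda>v. k * (S x \<bullet> v))) (at x)"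
    and pos: "sqrt ((norm (S x))\<^sup>2 + (a - \<rho> x)\<^sup>2) < \<kappa> * (a - \<rho> x)"
  defines "q \<equiv> sqrt ((norm (S x))\<^sup>2 + (a - \<rho> x)\<^sup>2)"
  shows "((\<lambda>x. refraction_factor \<kappa> (norm (S x)) (a - \<rho> x) *\<^sub>R S x) has_derivative
    (\<lambda>v. refraction_factor \<kappa> (norm (S x)) (a - \<rho> x) *\<^sub>R S' v -
      (\<kappa> * ((S x \<bullet> S' v - (a - \<rho> x) * k * (S x \<bullet> v)) / q + \<kappa> * k * (S x \<bullet> v)) /
        (q - \<kappa> * (a - \<rho> x))\<^sup>2) *\<^sub>R S x)) (at x)"
proof -
  \<comment> \<open>If a - \<rho> x were 0, \<open>pos\<close> would make a square root negative.
    Hence the radicand is positive and the root differentiable even where \<open>S x\<close> =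
    0.\<close>
  have "a - \<rho> x \<noteq> 0" using pos by auto
  then have sq: "(S x \<bullet> S x) + (a - \<rho> x)\<^sup>2 > 0"
    by (simp add: add_nonneg_pos)
  have q: "q = sqrt (S x \<bullet> S x + (a - \<rho> x)\<^sup>2)" "q > 0"
    using sq by (auto simp: q_def power2_norm_eq_inner)
  have u: "((\<lambda>x. a - \<rho> x) has_derivative (\<lambda>v. - (k * (S x \<bullet> v)))) (at x)"
    using \<rho> by (auto intro!: derivative_eq_intros)
  have "((\<lambda>x. S x \<bullet> S x + (a - \<rho> x)\<^sup>2) has_derivative
      (\<lambda>v. 2 * (S x \<bullet> S' v) - 2 * (a - \<rho> x) * (k * (S x \<bullet> v)))) (at x)"
    using has_derivative_add[OF has_derivative_inner[OF S S] has_derivative_power[OF u, of 2]]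
    by (rule has_derivative_eq_rhs) (simp add: fun_eq_iff inner_commute)
  then have "((\<lambda>x. sqrt (S x \<bullet> S x + (a - \<rho> x)\<^sup>2)) has_derivative
      (\<lambda>v. (2 * (S x \<bullet> S' v) - 2 * (a - \<rho> x) * (k * (S x \<bullet> v))) / (2 * q))) (at x)"
    unfolding q(1) by (rule has_derivative_sqrt) (rule sq)
  then have Q: "((\<lambda>x. sqrt (S x \<bullet> S x + (a - \<rho> x)\<^sup>2)) has_derivative
      (\<lambda>v. (S x \<bullet> S' v - (a - \<rho> x) * k * (S x \<bullet> v)) / q)) (at x)"
    by (rule has_derivative_eq_rhs) (use q(2) in \<open>simp add: fun_eq_iff field_simps\<close>)
  have \<kappa>u: "((\<lambda>x. \<kappa> * (a - \<rho> x)) has_derivative (\<lambda>v. \<kappa> * - (k * (S x \<bullet> v)))) (at x)"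
    by (intro has_derivative_mult_right u)
  have D: "((\<lambda>x. sqrt (S x \<bullet> S x + (a - \<rho> x)\<^sup>2) - \<kappa> * (a - \<rho> x)) has_derivative
      (\<lambda>v. (S x \<bullet> S' v - (a - \<rho> x) * k * (S x \<bullet> v)) / q + \<kappa> * k * (S x \<bullet> v))) (at x)"
    using has_derivative_diff[OF Q \<kappa>u] by (rule has_derivative_eq_rhs) (simp add: fun_eq_iff)
  have nz: "q - \<kappa> * (a - \<rho> x) \<noteq> 0" using pos by (simp add: q_def)
  have "((\<lambda>x. \<kappa> / (sqrt (S x \<bullet> S x + (a - \<rho> x)\<^sup>2) - \<kappa> * (a - \<rho> x))) has_derivative
      (\<lambda>v. - (\<kappa> * ((S x \<bullet> S' v - (a - \<rho> x) * k * (S x \<bullet> v)) / q + \<kappa> * k * (S x \<bullet> v)) /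
        (q - \<kappa> * (a - \<rho> x))\<^sup>2))) (at x)"
    by (rule has_derivative_eq_rhs, rule has_derivative_divide', rule has_derivative_const, rule D)
      (use nz in \<open>simp_all add: q(1)[symmetric] power2_eq_square[of "q - _"]\<close>)
  from has_derivative_scaleR[OF this S]
  show ?thesis
    unfolding refraction_factor_def power2_norm_eq_inner
    by (rule has_derivative_eq_rhs) (simp add: fun_eq_iff)
qed

text \<open>The two hypotheses on \<open>S\<close> meet here. The part of the derivative containing
  S' is symmetric because \<open>S\<close> is curl free; the remaining part pairs with w as a
  coefficient in v times S \<bullet> w, and is symmetric by \<open>par\<close>. So the field is a
  gradient again, which keeps the iteration going.\<close>

lemma refraction_field_C1:
  fixes S :: "'a::real_inner \<Rightarrow> 'a"
  assumes S: "\<And>x. x \<in> U \<Longrightarrow> (S has_derivative S' x) (at x)"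
    and S': "\<And>v. continuous_on U (\<lambda>x. S' x v)"
    and sym: "\<And>x v w. x \<in> U \<Longrightarrow> S' x v \<bullet> w = S' x w \<bullet> v"
    and par: "\<And>x v w. x \<in> U \<Longrightarrow> (S x \<bullet> S' x v) * (S x \<bullet> w) = (S x \<bullet> S' x w) * (S x \<bullet> v)"
    and k: "continuous_on U k"
    and \<rho>: "\<And>x. x \<in> U \<Longrightarrow> (\<rho> has_derivative (\<lambda>v. k x * (S x \<bullet> v))) (at x)"
    and pos: "\<And>x. x \<in> U \<Longrightarrow> sqrt ((norm (S x))\<^sup>2 + (a - \<rho> x)\<^sup>2) < \<kappa> * (a - \<rho> x)"
  shows "\<exists>F'. (\<forall>x\<in>U. ((\<lambda>x. refraction_factor \<kappa> (norm (S x)) (a - \<rho> x) *\<^sub>R S x) has_derivative F' x) (at x)) \<and>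
    (\<forall>v. continuous_on U (\<lambda>x. F' x v)) \<and>
    (\<forall>x\<in>U. \<forall>v w. F' x v \<bullet> w = F' x w \<bullet> v)"
    and "continuous_on U (\<lambda>x. refraction_factor \<kappa> (norm (S x)) (a - \<rho> x))"
proof -
  define q where "q x = sqrt ((norm (S x))\<^sup>2 + (a - \<rho> x)\<^sup>2)" for x
  define F' where "F' x v = refraction_factor \<kappa> (norm (S x)) (a - \<rho> x) *\<^sub>R S' x v -
      (\<kappa> * ((S x \<bullet> S' x v - (a - \<rho> x) * k x * (S x \<bullet> v)) / q x + \<kappa> * k x * (S x \<bullet> v)) /
        (q x - \<kappa> * (a - \<rho> x))\<^sup>2) *\<^sub>R S x" for x v
  have contS: "continuous_on U S" and cont\<rho>: "continuous_on U \<rho>"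
    using S \<rho> by (auto intro!: continuous_at_imp_continuous_on has_derivative_continuous)
  have contq: "continuous_on U q"
    unfolding q_def by (intro continuous_intros contS cont\<rho>)
  have nz: "q x - \<kappa> * (a - \<rho> x) \<noteq> 0" "q x \<noteq> 0" if "x \<in> U" for x
  proof -
    have "a - \<rho> x \<noteq> 0" using pos[OF that] by auto
    then have "(norm (S x))\<^sup>2 + (a - \<rho> x)\<^sup>2 > 0" by (simp add: add_nonneg_pos)
    then have "q x > 0" by (simp only: q_def real_sqrt_gt_0_iff)
    then show "q x \<noteq> 0" by simp
    show "q x - \<kappa> * (a - \<rho> x) \<noteq> 0" using pos[OF that] by (simp add: q_def)
  qed
  show contG: "continuous_on U (\<lambda>x. refraction_factor \<kappa> (norm (S x)) (a - \<rho> x))"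
    unfolding refraction_factor_def q_def[symmetric]
    by (intro continuous_intros contq cont\<rho>) (use nz in auto)
  have "((\<lambda>x. refraction_factor \<kappa> (norm (S x)) (a - \<rho> x) *\<^sub>R S x) has_derivative F' x) (at x)"
    if "x \<in> U" for x
    using refraction_field_derivative[OF S[OF that] \<rho>[OF that] pos[OF that]]
    unfolding F'_def q_def .
  moreover have "continuous_on U (\<lambda>x. F' x v)" for v
    unfolding F'_def by (intro continuous_intros contG contS contq cont\<rho> k S') (use nz in auto)
  moreover have "F' x v \<bullet> w = F' x w \<bullet> v" if "x \<in> U" for x v w
  proof -
    \<comment> \<open>The products containing S' are exchanged by \<open>par\<close>; the others are
      multiples of (S \<bullet> v)(S \<bullet> w), already symmetric.\<close>
    have "((S x \<bullet> S' x v - (a - \<rho> x) * k x * (S x \<bullet> v)) / q x + \<kappa> * k x * (S x \<bullet> v)) * (S x \<bullet> w)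
        = ((S x \<bullet> S' x w - (a - \<rho> x) * k x * (S x \<bullet> w)) / q x + \<kappa> * k x * (S x \<bullet> w)) * (S x \<bullet> v)"
      using par[OF that, of v w] nz(2)[OF that] by (simp add: field_simps)
    then show ?thesis
      unfolding F'_def by (simp add: inner_diff_left sym[OF that, of v w] mult.assoc)
  qed
  ultimately show "\<exists>F'. (\<forall>x\<in>U. ((\<lambda>x. refraction_factor \<kappa> (norm (S x)) (a - \<rho> x) *\<^sub>R S x) has_derivative F' x) (at x)) \<and>
    (\<forall>v. continuous_on U (\<lambda>x. F' x v)) \<and>
    (\<forall>x\<in>U. \<forall>v w. F' x v \<bullet> w = F' x w \<bullet> v)"
    by blast
qed

text \<open>Packages the consequences of the margin \<open>m\<close>, with K = \<kappa> / m and L =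
  \<kappa> (\<kappa> + 1) / m^2. It is applied at \<open>x0\<close> for existence and at every point
  of the competing domain for uniqueness.\<close>

lemma refraction_factor_local_bounds:
  fixes S :: "'a::real_normed_vector \<Rightarrow> 'b::real_normed_vector"
  assumes S: "isCont S p" and "\<kappa> > 1" and r: "sqrt ((norm (S p))\<^sup>2 + (a - r)\<^sup>2) < \<kappa> * (a - r)"
  obtains d e K L where "d > 0" "e > 0" "K \<ge> 0" "L \<ge> 0"
    "\<And>x. x \<in> ball p d \<Longrightarrow> norm (S x) \<le> norm (S p) + 1"
    "\<And>x s. x \<in> ball p d \<Longrightarrow> \<bar>s - r\<bar> \<le> e \<Longrightarrow>
       sqrt ((norm (S x))\<^sup>2 + (a - s)\<^sup>2) < \<kappa> * (a - s)"
    "\<And>x s. x \<in> ball p d \<Longrightarrow> \<bar>s - r\<bar> \<le> e \<Longrightarrow>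
       \<bar>refraction_factor \<kappa> (norm (S x)) (a - s)\<bar> \<le> K"
    "\<And>x s t. x \<in> ball p d \<Longrightarrow> \<bar>s - r\<bar> \<le> e \<Longrightarrow> \<bar>t - r\<bar> \<le> e \<Longrightarrow>
       \<bar>refraction_factor \<kappa> (norm (S x)) (a - s) - refraction_factor \<kappa> (norm (S x)) (a - t)\<bar>
         \<le> L * \<bar>s - t\<bar>"
proof -
  obtain d e m where "d > 0" "e > 0" "m > 0"
    and S1: "\<And>x. x \<in> ball p d \<Longrightarrow> norm (S x) \<le> norm (S p) + 1"
    and m: "\<And>x s. x \<in> ball p d \<Longrightarrow> \<bar>s - r\<bar> \<le> e \<Longrightarrow>
              m \<le> \<kappa> * (a - s) - sqrt ((norm (S x))\<^sup>2 + (a - s)\<^sup>2)"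
    using refraction_slope_margin[OF S r] by metis
  have L: "\<bar>refraction_factor \<kappa> (norm (S x)) (a - s) - refraction_factor \<kappa> (norm (S x)) (a - t)\<bar>
      \<le> \<kappa> * (\<kappa> + 1) / m\<^sup>2 * \<bar>s - t\<bar>"
    if "x \<in> ball p d" "\<bar>s - r\<bar> \<le> e" "\<bar>t - r\<bar> \<le> e" for x s t
    using refraction_factor_bounds(2)[OF \<open>\<kappa> > 1\<close> \<open>m > 0\<close> m[OF that(1,2)] m[OF that(1,3)]]
    by (simp add: abs_minus_commute)
  have K: "\<bar>refraction_factor \<kappa> (norm (S x)) (a - s)\<bar> \<le> \<kappa> / m"
    if "x \<in> ball p d" "\<bar>s - r\<bar> \<le> e" for x s
    using refraction_factor_bounds(1)[OF \<open>\<kappa> > 1\<close> \<open>m > 0\<close> m[OF that]] .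
  have pos: "sqrt ((norm (S x))\<^sup>2 + (a - s)\<^sup>2) < \<kappa> * (a - s)"
    if "x \<in> ball p d" "\<bar>s - r\<bar> \<le> e" for x s
    using m[OF that] \<open>m > 0\<close> by linarith
  have "\<kappa> / m \<ge> 0" "\<kappa> * (\<kappa> + 1) / m\<^sup>2 \<ge> 0"
    using \<open>\<kappa> > 1\<close> \<open>m > 0\<close> by simp_all
  from that[OF \<open>d > 0\<close> \<open>e > 0\<close> this S1 pos K L] show thesis .
qed

section \<open>Local existence and uniqueness for the refraction system\<close>

theorem corollary4p3:
  fixes \<Omega> \<Omega>' W :: "(real^2) set"
    and T S :: "real^2 \<Rightarrow> real^2"
    and a \<kappa>1 z0 :: real
    and x0 :: "real^2"
  assumes "open \<Omega>" and "simply_connected \<Omega>"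
    and "open \<Omega>'" and "simply_connected \<Omega>'"
    and "Ck_on 1 T \<Omega>" and "bij_betw T \<Omega> \<Omega>'"
    and "S = (\<lambda>x. T x - x)"
    and "a > 0" and "\<kappa>1 > 1"
    and "x0 \<in> \<Omega>" and "a > norm (S x0) / sqrt (\<kappa>1\<^sup>2 - 1)"
    and "a > z0" and "z0 > norm (S x0) / sqrt (\<kappa>1\<^sup>2 - 1)"
    and "open W" and "x0 \<in> W" and "W \<subseteq> \<Omega>"
    and "\<forall>x\<in>W. curl2 S x = 0"
    and "\<forall>x\<in>W. cross2 (S x) (grad (\<lambda>y. (norm (S y))\<^sup>2) x) = 0"
  shows "\<exists>U \<rho>. open U \<and> connected U \<and> x0 \<in> U \<and> U \<subseteq> \<Omega> \<and>
           positive_solution \<kappa>1 a S x0 z0 U \<rho> \<and>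
           (\<forall>V \<rho>'. open V \<and> connected V \<and> x0 \<in> V \<and> V \<subseteq> U \<and>
              positive_solution \<kappa>1 a S x0 z0 V \<rho>' \<longrightarrow> (\<forall>x\<in>V. \<rho>' x = \<rho> x))"
proof -
  note \<kappa> = \<open>\<kappa>1 > 1\<close>
  define G where "G x s = refraction_factor \<kappa>1 (norm (S x)) (a - s)" for x s
  define S' where "S' x v = frechet_derivative T (at x) v - v" for x v
  define r0 where "r0 = a - z0"
  have T: "Ck_on (Suc 0) T \<Omega>" using \<open>Ck_on 1 T \<Omega>\<close> by (simp only: One_nat_def)
  have dS: "(S has_derivative S' x) (at x)" if "x \<in> \<Omega>" for x
    unfolding \<open>S = (\<lambda>x. T x - x)\<close> S'_def
    by (intro has_derivative_diff Ck_on_1D(1)[OF T that] has_derivative_ident)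
  have cS': "continuous_on \<Omega> (\<lambda>x. S' x v)" for v
    unfolding S'_def by (intro continuous_intros Ck_on_1D(2)[OF T])
  have sym: "S' x v \<bullet> w = S' x w \<bullet> v" if "x \<in> W" for x v w
    using curl2_eq_0_imp_symmetric[OF dS] that \<open>W \<subseteq> \<Omega>\<close> \<open>\<forall>x\<in>W. curl2 S x = 0\<close> by blast
  have par: "(S x \<bullet> S' x v) * (S x \<bullet> w) = (S x \<bullet> S' x w) * (S x \<bullet> v)" if "x \<in> W" for x v w
    using cross2_grad_norm_sq_eq_0_imp_parallel[OF dS] that \<open>W \<subseteq> \<Omega>\<close>
      \<open>\<forall>x\<in>W. cross2 (S x) (grad (\<lambda>y. (norm (S y))\<^sup>2) x) = 0\<close> by blast
  have isS: "isCont S x" if "x \<in> \<Omega>" for x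
    using dS[OF that] by (rule has_derivative_continuous)
  have slope: "a - r > norm (S x) / sqrt (\<kappa>1\<^sup>2 - 1) \<longleftrightarrow>
      sqrt ((norm (S x))\<^sup>2 + (a - r)\<^sup>2) < \<kappa>1 * (a - r)" for x r
    by (rule slope_condition_iff[OF \<kappa>]) simp
  have s0: "sqrt ((norm (S x0))\<^sup>2 + (a - r0)\<^sup>2) < \<kappa>1 * (a - r0)"
    using \<open>z0 > norm (S x0) / sqrt (\<kappa>1\<^sup>2 - 1)\<close> slope[of x0 r0] by (simp add: r0_def)
  obtain d1 e1 K L where "d1 > 0" "e1 > 0" "K \<ge> 0" "L \<ge> 0"
    and S1: "\<And>x. x \<in> ball x0 d1 \<Longrightarrow> norm (S x) \<le> norm (S x0) + 1"
    and pos1: "\<And>x s. x \<in> ball x0 d1 \<Longrightarrow> \<bar>s - r0\<bar> \<le> e1 \<Longrightarrow>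
          sqrt ((norm (S x))\<^sup>2 + (a - s)\<^sup>2) < \<kappa>1 * (a - s)"
    and K1: "\<And>x s. x \<in> ball x0 d1 \<Longrightarrow> \<bar>s - r0\<bar> \<le> e1 \<Longrightarrow> \<bar>G x s\<bar> \<le> K"
    and L1: "\<And>x s t. x \<in> ball x0 d1 \<Longrightarrow> \<bar>s - r0\<bar> \<le> e1 \<Longrightarrow> \<bar>t - r0\<bar> \<le> e1 \<Longrightarrow>
          \<bar>G x s - G x t\<bar> \<le> L * \<bar>s - t\<bar>"
  proof (rule refraction_factor_local_bounds[OF isS[OF \<open>x0 \<in> \<Omega>\<close>] \<kappa> s0, folded G_def], goal_cases)
    case 1
    from 1(2-) show ?case by (rule 1(1))
  qed
  obtain d2 where "d2 > 0" and d2: "ball x0 d2 \<subseteq> W"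
    using \<open>open W\<close> \<open>x0 \<in> W\<close> open_contains_ball by blast
  have "r0 > 0" using \<open>a > z0\<close> by (simp add: r0_def)
  define M where "M = norm (S x0) + 1"
  have "M > 0" unfolding M_def using norm_ge_zero[of "S x0"] by linarith
  \<comment> \<open>Staying within e \<le> r0 / 2 of \<open>r0\<close> keeps \<rho> positive; e
    \<le> e1 keeps the slope condition and the bounds on \<open>G\<close> available.\<close>
  define e where "e = min e1 (r0 / 2)"
  have e: "e > 0" "e \<le> e1" "e < r0" using \<open>e1 > 0\<close> \<open>r0 > 0\<close> by (auto simp: e_def)
  \<comment> \<open>The ball must lie in \<open>W\<close> and in the region of the local bounds; the
    last two entries give K M d \<le> e and L M d \<le> 1/2, the added 1 guarding against zero
    denominators.\<close>
  define d where "d = min (min d1 d2) (min (e / (K * M + 1)) (1 / (2 * (L * M + 1))))"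
  have KM: "K * M \<ge> 0" "L * M \<ge> 0" using \<open>K \<ge> 0\<close> \<open>L \<ge> 0\<close> \<open>M > 0\<close> by simp_all
  have d: "d > 0" "d \<le> d1" "d \<le> d2" "d \<le> e / (K * M + 1)" "d \<le> 1 / (2 * (L * M + 1))"
    using \<open>d1 > 0\<close> \<open>d2 > 0\<close> e(1) KM by (auto simp: d_def)
  have "(K * M + 1) * d \<le> e" using d(4) KM by (simp add: le_divide_eq mult.commute)
  then have small1: "K * M * d \<le> e" using d(1) by (simp add: distrib_right)
  have "2 * (L * M + 1) * d \<le> 1" using d(5) KM by (simp add: le_divide_eq mult.commute)
  then have small2: "L * M * d \<le> 1 / 2" using d(1) by (simp add: algebra_simps)
  let ?B = "ball x0 d"
  have B: "?B \<subseteq> W" "?B \<subseteq> \<Omega>" "?B \<subseteq> ball x0 d1"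
    using d2 d(2,3) \<open>W \<subseteq> \<Omega>\<close> by (auto simp: subset_iff)
  \<comment> \<open>Used twice: for each iterate, to supply the hypothesis \<open>step\<close> of
    the Picard lemma, and later for the solution itself, to obtain second derivatives.\<close>
  have C1: "\<exists>F'. (\<forall>x\<in>?B. ((\<lambda>x. G x (\<rho> x) *\<^sub>R S x) has_derivative F' x) (at x)) \<and>
      (\<forall>v. continuous_on ?B (\<lambda>x. F' x v)) \<and> (\<forall>x\<in>?B. \<forall>v w. F' x v \<bullet> w = F' x w \<bullet> v)"
    "continuous_on ?B (\<lambda>x. G x (\<rho> x))"
    if k: "continuous_on ?B k"
      and \<rho>: "\<And>x. x \<in> ?B \<Longrightarrow> (\<rho> has_derivative (\<lambda>v. k x * (S x \<bullet> v))) (at x)"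
      and \<rho>e: "\<And>x. x \<in> ?B \<Longrightarrow> \<bar>\<rho> x - r0\<bar> \<le> e" for \<rho> k
  proof -
    have pos: "sqrt ((norm (S x))\<^sup>2 + (a - \<rho> x)\<^sup>2) < \<kappa>1 * (a - \<rho> x)" if "x \<in> ?B" for x
      using pos1[of x "\<rho> x"] \<rho>e[OF that] that B(3) e(2) by auto
    note C = refraction_field_C1[where U = ?B and S = S and S' = S' and \<rho> = \<rho> and k = k and a = a and \<kappa> = \<kappa>1,
        OF _ continuous_on_subset[OF cS' B(2)] _ _ k \<rho> pos]
    show "\<exists>F'. (\<forall>x\<in>?B. ((\<lambda>x. G x (\<rho> x) *\<^sub>R S x) has_derivative F' x) (at x)) \<and>
        (\<forall>v. continuous_on ?B (\<lambda>x. F' x v)) \<and> (\<forall>x\<in>?B. \<forall>v w. F' x v \<bullet> w = F' x w \<bullet> v)"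
      unfolding G_def by (rule C(1)) (use dS sym par B in blast)+
    show "continuous_on ?B (\<lambda>x. G x (\<rho> x))"
      unfolding G_def by (rule C(2)) (use dS sym par B in blast)+
  qed
  have "\<exists>\<rho>. \<rho> x0 = r0 \<and> (\<forall>x\<in>?B. \<bar>\<rho> x - r0\<bar> \<le> e \<and>
           (\<rho> has_derivative (\<lambda>v. G x (\<rho> x) * (S x \<bullet> v))) (at x))"
  proof (rule picard_gradient_system[where K = K and L = L and M = M])
    show "norm (S x) \<le> M" if "x \<in> ?B" for x using S1 that B(3) by (auto simp: M_def)
    show "\<bar>G x s\<bar> \<le> K" if "x \<in> ?B" "\<bar>s - r0\<bar> \<le> e" for x s
      using K1[of x s] that B(3) e(2) by auto
    show "\<bar>G x s - G x t\<bar> \<le> L * \<bar>s - t\<bar>"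
      if "x \<in> ?B" "\<bar>s - r0\<bar> \<le> e" "\<bar>t - r0\<bar> \<le> e" for x s t
      using L1[of x s t] that B(3) e(2) by auto
    show "continuous_on ?B (\<lambda>x. G x (\<rho> x)) \<and> (\<exists>\<sigma>. \<sigma> x0 = r0 \<and>
        (\<forall>x\<in>?B. (\<sigma> has_derivative (\<lambda>v. G x (\<rho> x) * (S x \<bullet> v))) (at x)))"
      if k: "continuous_on ?B k"
        and \<rho>: "\<And>x. x \<in> ?B \<Longrightarrow> (\<rho> has_derivative (\<lambda>v. k x * (S x \<bullet> v))) (at x)"
        and \<rho>e: "\<And>x. x \<in> ?B \<Longrightarrow> \<bar>\<rho> x - r0\<bar> \<le> e" for \<rho> k
    proof
      obtain F' where F': "\<And>x. x \<in> ?B \<Longrightarrow> ((\<lambda>x. G x (\<rho> x) *\<^sub>R S x) has_derivative F' x) (at x)"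
        "\<And>v. continuous_on ?B (\<lambda>x. F' x v)"
        "\<And>x v w. x \<in> ?B \<Longrightarrow> F' x v \<bullet> w = F' x w \<bullet> v"
        using C1(1)[OF k \<rho> \<rho>e] by blast
      \<comment> \<open>The next iterate is the potential of the symmetric field G(x, \<rho>)
        S.\<close>
      show "\<exists>\<sigma>. \<sigma> x0 = r0 \<and> (\<forall>x\<in>?B. (\<sigma> has_derivative (\<lambda>v. G x (\<rho> x) * (S x \<bullet> v))) (at x))"
        using symmetric_derivative_imp_gradient[where ?x0.0 = x0 and c = r0, OF open_ball convex_ball _ F'] d(1)
        by (simp add: inner_scaleR_left)
      show "continuous_on ?B (\<lambda>x. G x (\<rho> x))" using C1(2)[OF k \<rho> \<rho>e] .
    qed
  qed (use d(1) e(1) \<open>K \<ge> 0\<close> \<open>L \<ge> 0\<close> \<open>M > 0\<close> small1 small2 in auto)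
  then obtain \<rho> where \<rho>0: "\<rho> x0 = r0" and \<rho>e: "\<And>x. x \<in> ?B \<Longrightarrow> \<bar>\<rho> x - r0\<bar> \<le> e"
    and d\<rho>: "\<And>x. x \<in> ?B \<Longrightarrow> (\<rho> has_derivative (\<lambda>v. G x (\<rho> x) * (S x \<bullet> v))) (at x)"
    by blast
  have pos: "sqrt ((norm (S x))\<^sup>2 + (a - \<rho> x)\<^sup>2) < \<kappa>1 * (a - \<rho> x)" if "x \<in> ?B" for x
    using pos1[of x "\<rho> x"] \<rho>e[OF that] that B(3) e(2) by auto
  have contS: "continuous_on ?B S"
    using isS B(2) by (intro continuous_at_imp_continuous_on) blast
  have cont\<rho>: "continuous_on ?B \<rho>"
    using has_derivative_continuous[OF d\<rho>] by (intro continuous_at_imp_continuous_on) blast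
  \<comment> \<open>The solution satisfies the premises of \<open>C1\<close> with k x = G x (\<rho>
    x), once this k is known to be continuous. The resulting derivative of the gradient field is the
    bootstrap to class C^2.\<close>
  have cG: "continuous_on ?B (\<lambda>x. G x (\<rho> x))"
    unfolding G_def refraction_factor_def
    by (intro continuous_intros contS cont\<rho> ballI) (use pos in force)
  obtain F' where F': "\<And>x. x \<in> ?B \<Longrightarrow> ((\<lambda>x. G x (\<rho> x) *\<^sub>R S x) has_derivative F' x) (at x)"
    "\<And>v. continuous_on ?B (\<lambda>x. F' x v)"
    using C1(1)[OF cG d\<rho> \<rho>e] by blast
  have g\<rho>: "(\<rho> has_derivative (\<lambda>v. (G x (\<rho> x) *\<^sub>R S x) \<bullet> v)) (at x)" if "x \<in> ?B" for x
    using d\<rho>[OF that] by simp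
  have factor: "\<kappa>1 / (sqrt ((norm (S x))\<^sup>2 + (a - s)\<^sup>2) - \<kappa>1 * (a - s)) = G x s" for x s
    by (simp add: G_def refraction_factor_def)
  have sol: "positive_solution \<kappa>1 a S x0 z0 ?B \<rho>"
    unfolding positive_solution_def factor
  proof (intro conjI ballI)
    show "Ck_on 2 \<rho> ?B" by (rule Ck_on_2I[OF open_ball g\<rho> F'])
    fix x assume x: "x \<in> ?B"
    show "\<rho> x > 0" using \<rho>e[OF x] e(3) by linarith
    then show "a > a - \<rho> x" by simp
    show "grad \<rho> x = G x (\<rho> x) *\<^sub>R S x" by (rule grad_eq[OF g\<rho>[OF x]])
    show "a - \<rho> x > norm (S x) / sqrt (\<kappa>1\<^sup>2 - 1)" using slope pos[OF x] by blast
  next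
    show "a - \<rho> x0 = z0" by (simp add: \<rho>0 r0_def)
  qed
  have uniq: "\<sigma> x = \<rho> x"
    if V: "open V" "connected V" "x0 \<in> V" "V \<subseteq> ?B" and \<sigma>: "positive_solution \<kappa>1 a S x0 z0 V \<sigma>"
      and x: "x \<in> V" for V \<sigma> x
  proof (rule gradient_system_unique[OF V(1-3) _ _ _ _ x, where S = S and G = G])
    show "\<sigma> x0 = \<rho> x0" using \<sigma> by (simp add: positive_solution_def \<rho>0 r0_def)
    show "(\<rho> has_derivative (\<lambda>v. G y (\<rho> y) * (S y \<bullet> v))) (at y)" if "y \<in> V" for y
      using d\<rho> that V(4) by blast
    show "(\<sigma> has_derivative (\<lambda>v. G y (\<sigma> y) * (S y \<bullet> v))) (at y)" if "y \<in> V" for y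
    proof -
      have "\<sigma> differentiable (at y)"
        using \<sigma> that unfolding positive_solution_def by (simp add: numeral_2_eq_2)
      then obtain \<sigma>' where \<sigma>': "(\<sigma> has_derivative \<sigma>') (at y)" unfolding differentiable_def by blast
      have "grad \<sigma> y = G y (\<sigma> y) *\<^sub>R S y"
        using \<sigma> that unfolding positive_solution_def factor by blast
      with \<sigma>' grad_inner_eq[OF \<sigma>'] show ?thesis by (simp add: inner_scaleR_left)
    qed
    \<comment> \<open>Since \<rho> satisfies the slope condition on the whole ball, a margin, hence
      a Lipschitz constant for \<open>G\<close>, exists around (p, \<rho> p) for every such
      \<open>p\<close>.\<close>
    fix p assume p: "p \<in> V"
    then have p\<Omega>: "p \<in> \<Omega>" and pB: "p \<in> ?B" using V(4) B(2) by auto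
    show "\<exists>d>0. \<exists>e>0. \<exists>L\<ge>0. \<exists>M\<ge>0. \<forall>x\<in>ball p d. norm (S x) \<le> M \<and>
        (\<forall>s t. \<bar>s - \<rho> p\<bar> \<le> e \<longrightarrow> \<bar>t - \<rho> p\<bar> \<le> e \<longrightarrow> \<bar>G x s - G x t\<bar> \<le> L * \<bar>s - t\<bar>)"
    proof (rule refraction_factor_local_bounds[OF isS[OF p\<Omega>] \<kappa> pos[OF pB], folded G_def], goal_cases)
      case (1 d e K L)
      show ?case
        by (intro exI[of _ d] exI[of _ e] exI[of _ L] exI[of _ "norm (S p) + 1"] conjI ballI allI impI)
          (use 1 in \<open>simp_all add: add_nonneg_nonneg\<close>)
    qed
  qed
  show ?thesis
  proof (intro exI[of _ ?B] exI[of _ \<rho>] conjI allI impI ballI)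
    show "open ?B" "connected ?B" "x0 \<in> ?B" "?B \<subseteq> \<Omega>"
      using d(1) B(2) by (auto intro: convex_connected)
    show "positive_solution \<kappa>1 a S x0 z0 ?B \<rho>" by (rule sol)
  qed (use uniq in blast)
qed

end
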